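(* Let $R$ be a ring, $\mathfrak{m}\in\mathrm{Max}(R)$, and let $\kappa\subseteq R$ be a field. The following properties are equivalent: (1) The inclusion $\phi\colon\mathfrak{m}\rtimes\kappa\subseteq R$, $(x,u)\mapsto x+u$, is an isomorphism, which is equivalent to $\mathfrak{m}$ and $\kappa$ exhibiting property $(\star)$ for $R$. (2) For every element $a\in R$, there exist $x\in\mathfrak{m}$ and $u\in\kappa$ such that $a=x+u$, which is equivalent to $R\cong\mathfrak{m}\oplus\kappa$ as additive groups.
   Context: Conventions: rings are unitary (not assumed commutative), ring homomorphisms preserve $1$, ideals are two-sided, and subfields of a ring share its $1$. $\mathrm{Max}(R)$ is the set of maximal ideals of $R$. Given $\mathfrak{m}\in\mathrm{Max}(R)$ and a field $\kappa\subseteq R$, the semidirect product $\mathfrak{m}\rtimes\kappa$ is the unitary ring with additive group $\mathfrak{m}\oplus\kappa$ and product $(x,u)\cdot(y,v)=(xy+uy+xv,\,uv)$, products being taken in $R$; its identity is $(0,1)$. The map $\phi\colon\mathfrak{m}\rtimes\kappa\to R$, $(x,u)\mapsto x+u$, is an injective ring homomorphism, so $\mathfrak{m}\rtimes\kappa$ is regarded as included in $R$. Property $(\star)$ for a ring $R$: there exists a maximal ideal $\mathfrak{m}$ of $R$ such that the canonical projection $\pi\colon R\to R/\mathfrak{m}$ has a section, so that $R/\mathfrak{m}$ is isomorphic to a field $\kappa$ contained in $R$. One says that $\mathfrak{m}\in\mathrm{Max}(R)$ and a field $\kappa\subseteq R$ exhibit property $(\star)$ for $R$ if there is a ring isomorphism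 $j\colon R/\mathfrak{m}\to\kappa$ such that the composite $s\colon R/\mathfrak{m}\xrightarrow{j}\kappa\subseteq R$ satisfies $\pi\circ s=\mathrm{id}$.
   Formalization: "R ≅ 𝔪⊕κ as additive groups" is taken to mean that the canonical map (x,u) ↦ x+u is an isomorphism of additive groups; with an arbitrary additive isomorphism the claim fails, e.g. for R=ℚ(t), 𝔪=0, κ=ℚ(t²). *)

theory Defs
  imports "HOL-Algebra.QuotRing" "HOL-Algebra.Subrings"
begin

definition semidirect_ring ::
    "('a, 'b) ring_scheme \<Rightarrow> 'a set \<Rightarrow> 'a set \<Rightarrow> ('a \<times> 'a) ring" where
  "semidirect_ring R \<mm> \<kappa> =
    \<lparr>carrier = \<mm> \<times> \<kappa>,
     monoid.mult = (\<lambda>(x, u) (y, v).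
       (x \<otimes>\<^bsub>R\<^esub> y \<oplus>\<^bsub>R\<^esub> u \<otimes>\<^bsub>R\<^esub> y \<oplus>\<^bsub>R\<^esub> x \<otimes>\<^bsub>R\<^esub> v, u \<otimes>\<^bsub>R\<^esub> v)),
     one = (\<zero>\<^bsub>R\<^esub>, \<one>\<^bsub>R\<^esub>),
     ring.zero = (\<zero>\<^bsub>R\<^esub>, \<zero>\<^bsub>R\<^esub>),
     add = (\<lambda>(x, u) (y, v). (x \<oplus>\<^bsub>R\<^esub> y, u \<oplus>\<^bsub>R\<^esub> v))\<rparr>"

definition add_direct_sum ::
    "('a, 'b) ring_scheme \<Rightarrow> 'a set \<Rightarrow> 'a set \<Rightarrow> ('a \<times> 'a) monoid" where
  "add_direct_sum R \<mm> \<kappa> =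
    add_monoid (R\<lparr>carrier := \<mm>\<rparr>) \<times>\<times> add_monoid (R\<lparr>carrier := \<kappa>\<rparr>)"

definition sum_map :: "('a, 'b) ring_scheme \<Rightarrow> 'a \<times> 'a \<Rightarrow> 'a" where
  "sum_map R = (\<lambda>(x, u). x \<oplus>\<^bsub>R\<^esub> u)"

text \<open>The section of the projection \<open>R \<rightarrow> R/\<mm>\<close> is \<open>j\<close> followed by
  the inclusion \<open>\<kappa> \<subseteq> R\<close>. The locale \<open>subfield\<close> covers
  (commutative) subfields containing \<open>\<one>\<^bsub>R\<^esub>\<close> of a ring that need not be commutative.\<close>

definition exhibits_star :: "('a, 'b) ring_scheme \<Rightarrow> 'a set \<Rightarrow> 'a set \<Rightarrow> bool" where
  "exhibits_star R \<mm> \<kappa> \<longleftrightarrow>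
    maximalideal \<mm> R \<and> subfield \<kappa> R \<and>
    (\<exists>j \<in> ring_iso (R Quot \<mm>) (R\<lparr>carrier := \<kappa>\<rparr>).
       \<forall>X \<in> carrier (R Quot \<mm>). \<mm> +>\<^bsub>R\<^esub> j X = X)"

lemma semidirect_ring_is_ring:
  assumes "ideal \<mm> R" "subring \<kappa> R"
  shows "ring (semidirect_ring R \<mm> \<kappa>)"
proof -
  interpret I: ideal \<mm> R by fact
  interpret K: subring \<kappa> R by fact
  have k: "u \<in> carrier R" if "u \<in> \<kappa>" for u using that K.subset by auto
  have kc: "u \<otimes>\<^bsub>R\<^esub> v \<in> \<kappa>" "u \<oplus>\<^bsub>R\<^esub> v \<in> \<kappa>" "\<zero>\<^bsub>R\<^esub> \<in> \<kappa>" "\<one>\<^bsub>R\<^esub> \<in> \<kappa>" "\<ominus>\<^bsub>R\<^esub> u \<in> \<kappa>"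
    if "u \<in> \<kappa>" "v \<in> \<kappa>" for u v
    using that K.m_closed K.subgroup_axioms I.ring_axioms
      subringE[OF \<open>subring \<kappa> R\<close>] by auto
  have z: "\<zero>\<^bsub>R\<^esub> \<in> \<kappa>" "\<one>\<^bsub>R\<^esub> \<in> \<kappa>" using subringE[OF \<open>subring \<kappa> R\<close>] by auto
  have mc: "x \<oplus>\<^bsub>R\<^esub> y \<in> \<mm>" "\<ominus>\<^bsub>R\<^esub> x \<in> \<mm>" if "x \<in> \<mm>" "y \<in> \<mm>" for x y
    using that I.a_closed I.a_inv_closed by auto
  note s = I.a_Hcarr I.I_l_closed I.I_r_closed mc k kc z
  show ?thesis
  proof (rule ringI)
    show "abelian_group (semidirect_ring R \<mm> \<kappa>)"
    proof (rule abelian_groupI)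
      fix p assume "p \<in> carrier (semidirect_ring R \<mm> \<kappa>)"
      then obtain x u where p: "p = (x, u)" "x \<in> \<mm>" "u \<in> \<kappa>"
        by (auto simp: semidirect_ring_def)
      then show "\<exists>q\<in>carrier (semidirect_ring R \<mm> \<kappa>).
          q \<oplus>\<^bsub>semidirect_ring R \<mm> \<kappa>\<^esub> p = \<zero>\<^bsub>semidirect_ring R \<mm> \<kappa>\<^esub>"
        by (intro bexI[of _ "(\<ominus>\<^bsub>R\<^esub> x, \<ominus>\<^bsub>R\<^esub> u)"])
           (auto simp: semidirect_ring_def s I.l_neg)
    qed (auto simp: semidirect_ring_def s I.add.m_ac)
    show "monoid (semidirect_ring R \<mm> \<kappa>)"
      by (rule monoidI)
         (auto simp: semidirect_ring_def s I.m_assoc I.r_distr I.l_distr I.add.m_ac)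
  qed (auto simp: semidirect_ring_def s I.r_distr I.l_distr I.add.m_ac)
qed

end

theory Submission
  imports Defs
begin

text \<open>A field meets a proper ideal \<open>\<mm>\<close> only in zero, so \<open>sum_map R\<close> is always an injective
  homomorphism, and it is an isomorphism exactly when \<open>\<mm> + \<kappa>\<close> is all of \<open>R\<close>. For the same
  reason the coset map \<open>\<kappa> \<rightarrow> R/\<mm>\<close> is injective; it is onto exactly when \<open>\<mm> + \<kappa> = R\<close>, and
  its inverse is then the isomorphism demanded by property \<open>(\<star>)\<close>.\<close>

context ring
begin

text \<open>A nonzero common element has its inverse in \<open>K\<close>; absorption then puts
  \<one> into \<open>I\<close>, which forces \<open>I\<close> to be the whole ring.\<close>

lemma proper_ideal_Int_subfield:
  assumes "ideal I R" "I \<noteq> carrier R" "subfield K R"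
  shows "I \<inter> K = {\<zero>}"
proof -
  interpret ideal I R by fact
  have "x = \<zero>" if "x \<in> I" "x \<in> K" for x
  proof (rule ccontr)
    assume "x \<noteq> \<zero>"
    then have "inv x \<in> K - {\<zero>}" "x \<otimes> inv x = \<one>"
      using subfield_m_inv[OF assms(3)] that by auto
    moreover have "K \<subseteq> carrier R"
      using subfieldE(3)[OF assms(3)] .
    ultimately have "\<one> \<in> I"
      using I_r_closed[OF \<open>x \<in> I\<close>, of "inv x"] by auto
    then show False
      using one_imp_carrier assms(2) by blast
  qed
  moreover have "\<zero> \<in> K"
    using subringE(2)[OF subfieldE(1)[OF assms(3)]] .
  ultimately show ?thesis by auto
qed

lemma sum_map_image_eq_carrier_iff:
  assumes "I \<subseteq> carrier R" "K \<subseteq> carrier R"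
  shows "sum_map R ` (I \<times> K) = carrier R \<longleftrightarrow> (\<forall>a \<in> carrier R. \<exists>x \<in> I. \<exists>u \<in> K. a = x \<oplus> u)"
  using assms unfolding sum_map_def by (fastforce simp: image_iff)

text \<open>Two decompositions of one element satisfy \<open>x \<ominus> y = v \<ominus> u\<close>,
  an element of both \<open>I\<close> and \<open>K\<close>. Only additive structure is involved, so
  one argument serves the ring and the group isomorphism.\<close>

lemma inj_on_sum_map:
  assumes "subgroup I (add_monoid R)" "subgroup K (add_monoid R)" "I \<inter> K = {\<zero>}"
  shows "inj_on (sum_map R) (I \<times> K)"
proof -
  interpret I: additive_subgroup I R using assms(1) by (simp add: additive_subgroup_def)
  interpret K: additive_subgroup K R using assms(2) by (simp add: additive_subgroup_def)
  have "x = y \<and> u = v"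
    if *: "x \<in> I" "y \<in> I" "u \<in> K" "v \<in> K" and eq: "x \<oplus> u = y \<oplus> v" for x y u v
  proof -
    have c: "x \<in> carrier R" "y \<in> carrier R" "u \<in> carrier R" "v \<in> carrier R"
      using * by auto
    \<comment> \<open>Inserting \<open>u\<close> twice creates the left side of \<open>eq\<close>,
      which can then be rewritten.\<close>
    have "x \<ominus> y = (x \<oplus> u) \<ominus> (y \<oplus> u)" using c by algebra
    also have "\<dots> = v \<ominus> u" unfolding eq using c by algebra
    finally have "x \<ominus> y = v \<ominus> u" .
    moreover have "x \<ominus> y \<in> I" "v \<ominus> u \<in> K"
      using * by (simp_all add: a_minus_def)
    ultimately have "x \<ominus> y = \<zero>" "v \<ominus> u = \<zero>"
      using assms(3) by auto
    then show ?thesis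
      using c by simp
  qed
  then show ?thesis
    by (auto simp: inj_on_def sum_map_def)
qed

text \<open>The semidirect product is the expansion of
  \<open>(x \<oplus> u) \<otimes> (y \<oplus> v)\<close>: the three terms with a factor in
  \<open>I\<close> form the first component, and \<open>u \<otimes> v\<close> is the second.\<close>

lemma sum_map_ring_hom:
  assumes "ideal I R" "subring K R"
  shows "sum_map R \<in> ring_hom (semidirect_ring R I K) R"
proof -
  interpret ideal I R by fact
  have K: "\<And>u. u \<in> K \<Longrightarrow> u \<in> carrier R"
    using subringE(1)[OF assms(2)] by blast
  show ?thesis
    by (rule ring_hom_memI)
      (auto simp: semidirect_ring_def sum_map_def K l_distr r_distr a_ac)
qed

lemma sum_map_add_hom:
  assumes "I \<subseteq> carrier R" "K \<subseteq> carrier R"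
  shows "sum_map R \<in> hom (add_direct_sum R I K) (add_monoid R)"
proof -
  have "x \<in> carrier R" if "x \<in> I \<union> K" for x using that assms by blast
  then show ?thesis
    by (intro homI) (auto simp: add_direct_sum_def sum_map_def a_ac)
qed

lemma exhibits_star_iff_sum:
  assumes "maximalideal I R" "subfield K R"
  shows "exhibits_star R I K \<longleftrightarrow> (\<forall>a \<in> carrier R. \<exists>x \<in> I. \<exists>u \<in> K. a = x \<oplus> u)"
proof -
  interpret maximalideal I R by fact
  have K: "subring K R" "K \<subseteq> carrier R"
    using subfieldE[OF assms(2)] by auto
  have Kc: "u \<in> carrier R" if "u \<in> K" for u using that K by blast
  have carrier_Quot: "carrier (R Quot I) = (+>) I ` carrier R"
    by (auto simp: FactRing_def A_RCOSETS_def')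
  show ?thesis
  proof
    assume "exhibits_star R I K"
    then obtain j where j: "j \<in> ring_iso (R Quot I) (R\<lparr>carrier := K\<rparr>)"
      and sec: "\<And>X. X \<in> carrier (R Quot I) \<Longrightarrow> I +> j X = X"
      unfolding exhibits_star_def by blast
    show "\<forall>a \<in> carrier R. \<exists>x \<in> I. \<exists>u \<in> K. a = x \<oplus> u"
    proof
      fix a assume a: "a \<in> carrier R"
      then have X: "I +> a \<in> carrier (R Quot I)" by (simp add: carrier_Quot)
      \<comment> \<open>The section equation makes \<open>j (I +> a)\<close> a representative of the
        coset of \<open>a\<close>, and this representative lies in \<open>K\<close>.\<close>
      have "a \<in> I +> j (I +> a)"
        using a_rcos_self[OF a] sec[OF X] by simp
      moreover have "j (I +> a) \<in> K"
        using ring_iso_memE(1)[OF j X] by simp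
      ultimately show "\<exists>x \<in> I. \<exists>u \<in> K. a = x \<oplus> u"
        by (auto simp: a_r_coset_def')
    qed
  next
    assume sum: "\<forall>a \<in> carrier R. \<exists>x \<in> I. \<exists>u \<in> K. a = x \<oplus> u"
    have "(+>) I \<in> ring_hom (R\<lparr>carrier := K\<rparr>) (R Quot I)"
      using ring_hom_memE[OF rcos_ring_hom] Kc by (intro ring_hom_memI) simp_all
    moreover have "inj_on ((+>) I) K"
    proof (rule inj_onI)
      fix u v assume uv: "u \<in> K" "v \<in> K" "I +> u = I +> v"
      then have "u \<ominus> v \<in> I"
        using quotient_eq_iff_same_a_r_cos[OF ideal_axioms] Kc by simp
      moreover have "u \<ominus> v \<in> K"
        using uv subringE(5,7)[OF K(1)] by (simp add: a_minus_def)
      ultimately have "u \<ominus> v = \<zero>"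
        using proper_ideal_Int_subfield[OF ideal_axioms I_notcarr[symmetric] assms(2)] by blast
      then show "u = v"
        using uv Kc by simp
    qed
    moreover have "(+>) I ` K = carrier (R Quot I)"
    proof
      show "(+>) I ` K \<subseteq> carrier (R Quot I)" using K(2) by (auto simp: carrier_Quot)
      show "carrier (R Quot I) \<subseteq> (+>) I ` K"
      proof
        fix X assume "X \<in> carrier (R Quot I)"
        then obtain a where a: "a \<in> carrier R" "X = I +> a" by (auto simp: carrier_Quot)
        then obtain x u where xu: "x \<in> I" "u \<in> K" "a = x \<oplus> u" using sum by blast
        \<comment> \<open>Cosets of \<open>I\<close> sharing the element \<open>a\<close> coincide,
          so \<open>u\<close> represents \<open>X\<close>.\<close>
        then have "a \<in> I +> u" by (auto simp: a_r_coset_def')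
        then have "X = I +> u"
          using a_repr_independence[OF _ Kc[OF xu(2)] a_subgroup] a(2) by simp
        then show "X \<in> (+>) I ` K" using xu(2) by blast
      qed
    qed
    ultimately have iso: "(+>) I \<in> ring_iso (R\<lparr>carrier := K\<rparr>) (R Quot I)"
      by (simp add: ring_iso_def bij_betw_def)
    \<comment> \<open>The inverse is taken relative to \<open>K\<close>, since the coset map need
      not be injective on all of \<open>R\<close>. The section equation is then the right-inverse
      law of \<open>inv_into\<close>.\<close>
    define j where "j = inv_into K ((+>) I)"
    have "ring (R\<lparr>carrier := K\<rparr>)"
      using subring_is_ring[OF K(1)] .
    then have "j \<in> ring_iso (R Quot I) (R\<lparr>carrier := K\<rparr>)"
      using ring_iso_set_sym[OF _ iso] by (simp add: j_def)
    moreover have "\<forall>X \<in> carrier (R Quot I). I +> j X = X"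
      using \<open>(+>) I ` K = carrier (R Quot I)\<close> by (metis f_inv_into_f j_def)
    ultimately show "exhibits_star R I K"
      using assms unfolding exhibits_star_def by blast
  qed
qed

end

theorem theorem3p5:
  fixes R :: "('a, 'b) ring_scheme" and \<mm> \<kappa> :: "'a set"
  assumes "ring R"
    and "maximalideal \<mm> R"
    and "subfield \<kappa> R"
  shows "(sum_map R \<in> ring_iso (semidirect_ring R \<mm> \<kappa>) R \<longleftrightarrow> exhibits_star R \<mm> \<kappa>)
    \<and> ((\<forall>a \<in> carrier R. \<exists>x \<in> \<mm>. \<exists>u \<in> \<kappa>. a = x \<oplus>\<^bsub>R\<^esub> u) \<longleftrightarrow>
         sum_map R \<in> iso (add_direct_sum R \<mm> \<kappa>) (add_monoid R))
    \<and> (sum_map R \<in> ring_iso (semidirect_ring R \<mm> \<kappa>) R \<longleftrightarrow>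
         (\<forall>a \<in> carrier R. \<exists>x \<in> \<mm>. \<exists>u \<in> \<kappa>. a = x \<oplus>\<^bsub>R\<^esub> u))"
proof -
  interpret ring R by fact
  interpret maximalideal \<mm> R by fact
  have K: "subring \<kappa> R" "\<kappa> \<subseteq> carrier R"
    using subfieldE[OF assms(3)] by auto
  have "inj_on (sum_map R) (\<mm> \<times> \<kappa>)"
    using inj_on_sum_map[OF a_subgroup subring.axioms(1)[OF K(1)]]
      proper_ideal_Int_subfield[OF ideal_axioms I_notcarr[symmetric] assms(3)] by simp
  then have bij: "bij_betw (sum_map R) (\<mm> \<times> \<kappa>) (carrier R) \<longleftrightarrow>
      (\<forall>a \<in> carrier R. \<exists>x \<in> \<mm>. \<exists>u \<in> \<kappa>. a = x \<oplus>\<^bsub>R\<^esub> u)"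
    using sum_map_image_eq_carrier_iff[OF a_subset K(2)] by (simp add: bij_betw_def)
  \<comment> \<open>Both structures have carrier \<open>\<mm> \<times> \<kappa>\<close> and
    \<open>sum_map R\<close> is a homomorphism from each, so both isomorphism claims reduce to the
    same bijectivity.\<close>
  have "sum_map R \<in> ring_iso (semidirect_ring R \<mm> \<kappa>) R \<longleftrightarrow>
      bij_betw (sum_map R) (\<mm> \<times> \<kappa>) (carrier R)"
    using sum_map_ring_hom[OF ideal_axioms K(1)]
    by (simp add: ring_iso_def semidirect_ring_def)
  moreover have "sum_map R \<in> iso (add_direct_sum R \<mm> \<kappa>) (add_monoid R) \<longleftrightarrow>
      bij_betw (sum_map R) (\<mm> \<times> \<kappa>) (carrier R)"
    using sum_map_add_hom[OF a_subset K(2)]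
    by (simp add: iso_def add_direct_sum_def)
  ultimately show ?thesis
    using bij exhibits_star_iff_sum[OF assms(2,3)] by blast
qed

end
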